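(* Let $X$ be a non-trivial complex Banach space, let $1\le p<\infty$, let $I=\mathbb{R}$ or $I=[0,\infty)$, and let $\omega\in I$, $\omega\neq 0$. Then $S^pSAP_\omega(I:X)\subseteq S^pQ\text{-}AAP(I:X)$.
   Context: $L_S^p(I:X)$ is the space of Stepanov $p$-bounded functions: $f\in L^p_{loc}(I:X)$ with $\|f\|_{S^p}:=\sup_{t\in I}\bigl(\int_t^{t+1}\|f(s)\|^p\,ds\bigr)^{1/p}<\infty$. $S^pSAP_\omega(I:X)$ (Stepanov $p$-asymptotically $\omega$-periodic functions) is the set of $f\in L_S^p(I:X)$ such that $\lim_{|t|\to\infty}\int_t^{t+1}\|f(s+\omega)-f(s)\|^p\,ds=0$. $S^pQ\text{-}AAP(I:X)$ (Stepanov $p$-quasi-asymptotically almost periodic functions) is the set of $f\in L_S^p(I:X)$ such that for each $\epsilon>0$ there exists a finite number $L(\epsilon)>0$ such that any interval $I'\subseteq I$ of length $L(\epsilon)$ contains at least one number $\tau\in I'$ for which there exists a finite number $M(\epsilon,\tau)>0$ with $\int_t^{t+1}\|f(s+\tau)-f(s)\|^p\,ds\le\epsilon^p$ for all $t\in I$ with $|t|\ge M(\epsilon,\tau)$. *)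

theory Defs
  imports "HOL-Analysis.Analysis"
begin

text \<open>
  Complex Banach spaces: a real Banach space whose real scalar multiplication and norm extend
  compatibly to complex scalars.
\<close>

class complex_banach = banach +
  fixes scaleC :: "complex \<Rightarrow> 'a \<Rightarrow> 'a"
  assumes scaleC_add_right: "scaleC c (x + y) = scaleC c x + scaleC c y"
    and scaleC_add_left: "scaleC (c + d) x = scaleC c x + scaleC d x"
    and scaleC_scaleC: "scaleC c (scaleC d x) = scaleC (c * d) x"
    and scaleC_of_real: "scaleC (complex_of_real r) x = scaleR r x"
    and norm_scaleC: "norm (scaleC c x) = cmod c * norm x"

instantiation complex :: complex_banach
begin

definition scaleC_complex :: "complex \<Rightarrow> complex \<Rightarrow> complex"
  where "scaleC_complex c x = c * x"

instance
  by standard (simp_all add: scaleC_complex_def algebra_simps norm_mult scaleR_conv_of_real)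

end

text \<open>
  A function \<open>I \<rightarrow> X\<close> is represented by a total function on the reals whose values outside \<open>I\<close>
  are irrelevant: for \<open>I\<close> the line or the half-line and shifts in \<open>I\<close>, none of the notions
  below evaluates it outside \<open>I\<close>, and none distinguishes functions that agree almost everywhere
  on \<open>I\<close>.

  Measurability is strong (Bochner) measurability, since \<open>X\<close> need not be separable and Borel
  measurability would be too weak.
\<close>

definition strongly_measurable_on :: "real set \<Rightarrow> (real \<Rightarrow> 'a::real_normed_vector) \<Rightarrow> bool"
  where "strongly_measurable_on I f \<longleftrightarrow>
    (\<exists>s :: nat \<Rightarrow> real \<Rightarrow> 'a. (\<forall>n. simple_function (lebesgue_on I) (s n)) \<and>
       (AE x in lebesgue_on I. (\<lambda>n. s n x) \<longlonglongrightarrow> f x))"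

definition Lp_loc :: "real \<Rightarrow> real set \<Rightarrow> (real \<Rightarrow> 'a::real_normed_vector) set"
  where "Lp_loc p I = {f. strongly_measurable_on I f \<and>
    (\<forall>K. compact K \<and> K \<subseteq> I \<longrightarrow> set_integrable lebesgue K (\<lambda>s. norm (f s) powr p))}"

text \<open>
  The integrals over \<open>[t, t + 1]\<close> below are real-valued Lebesgue integrals. They are always taken
  for members of \<^term>\<open>Lp_loc p I\<close>, so the integrands are integrable and the convention that the
  integral of a non-integrable function is zero plays no role.
\<close>

definition stepanov_norm :: "real \<Rightarrow> real set \<Rightarrow> (real \<Rightarrow> 'a::real_normed_vector) \<Rightarrow> ereal"
  where "stepanov_norm p I f =
    (SUP t\<in>I. ereal ((LINT s:{t..t + 1}|lebesgue. norm (f s) powr p) powr (1 / p)))"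

definition stepanov_bounded :: "real \<Rightarrow> real set \<Rightarrow> (real \<Rightarrow> 'a::real_normed_vector) set"
  where "stepanov_bounded p I = {f \<in> Lp_loc p I. stepanov_norm p I f < \<infinity>}"

text \<open>
  On the reals, \<^term>\<open>at_infinity\<close> is the filter of \<open>\<bar>t\<bar> \<rightarrow> \<infinity>\<close>; it is restricted to \<open>t \<in> I\<close>.
\<close>

definition SpSAP :: "real \<Rightarrow> real \<Rightarrow> real set \<Rightarrow> (real \<Rightarrow> 'a::real_normed_vector) set"
  where "SpSAP p \<omega> I = {f \<in> stepanov_bounded p I.
    ((\<lambda>t. LINT s:{t..t + 1}|lebesgue. norm (f (s + \<omega>) - f s) powr p) \<longlongrightarrow> 0)
      (inf at_infinity (principal I))}"

text \<open>
  The intervals \<open>J\<close> of length \<open>L\<close> may be open, closed or half-open.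
\<close>

definition SpQAAP :: "real \<Rightarrow> real set \<Rightarrow> (real \<Rightarrow> 'a::real_normed_vector) set"
  where "SpQAAP p I = {f \<in> stepanov_bounded p I.
    \<forall>\<epsilon>>0. \<exists>L>0. \<forall>J. is_interval J \<and> J \<subseteq> I \<and> emeasure lborel J = ennreal L \<longrightarrow>
      (\<exists>\<tau>\<in>J. \<exists>M>0. \<forall>t\<in>I. \<bar>t\<bar> \<ge> M \<longrightarrow>
         (LINT s:{t..t + 1}|lebesgue. norm (f (s + \<tau>) - f s) powr p) \<le> \<epsilon> powr p)}"

end

theory Submission
  imports Defs
begin

text \<open>
  Every interval of length \<open>3\<bar>\<omega>\<bar>\<close> contains an integer multiple \<open>k\<omega>\<close>, and each such multiple is an
  admissible almost period: \<open>f(\<cdot> + k\<omega>) - f\<close> telescopes into \<open>\<bar>k\<bar>\<close> translates of \<open>f(\<cdot> + \<omega>) - f\<close>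
  (up to sign), and translation does not affect limits as \<open>\<bar>t\<bar> \<rightarrow> \<infinity>\<close>.
\<close>

section \<open>Strong measurability of translated differences\<close>

lemma AE_lebesgue_translation:
  fixes c :: real
  assumes "AE x in lebesgue. P x"
  shows "AE x in lebesgue. P (x + c)"
proof -
  from assms have "AE x in lborel. P x"
    by (simp add: AE_completion_iff)
  then obtain N where N: "N \<in> null_sets lborel" "{x. \<not> P x} \<subseteq> N"
    by (auto simp: eventually_ae_filter)
  from null_sets_translation[OF N(1), of "-c"]
  have "AE x in lborel. P (x + c)"
    unfolding eventually_ae_filter using N(2) by (intro bexI[of _ "{x. x + c \<in> N}"]) auto
  then show ?thesis
    by (rule AE_completion)
qed

text \<open>Lets approximants living on \<open>I\<close> be composed with a translation, which need
  not map \<open>I\<close> into itself.\<close>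

lemma simple_function_lebesgue_on_extend:
  assumes "simple_function (lebesgue_on I) s" "I \<in> sets lebesgue"
  shows "simple_function lebesgue (\<lambda>x. if x \<in> I then s x else z)"
proof -
  have meas: "s -` {y} \<inter> I \<in> sets lebesgue" for y
  proof (cases "y \<in> s ` I")
    case True
    then have "s -` {y} \<inter> I \<in> sets (lebesgue_on I)"
      using assms(1) by (auto simp: simple_function_def)
    then show ?thesis
      using assms(2) by (simp add: sets_restrict_space_iff)
  next
    case False
    then have "s -` {y} \<inter> I = {}" by auto
    then show ?thesis by simp
  qed
  have "(\<lambda>x. if x \<in> I then s x else z) -` {y} =
      (s -` {y} \<inter> I) \<union> (if y = z then - I else {})" for y
    by (auto split: if_splits)
  moreover have "(\<lambda>x. if x \<in> I then s x else z) ` UNIV \<subseteq> insert z (s ` I)"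
    by auto
  moreover have "finite (s ` I)"
    using assms(1) by (simp add: simple_function_def)
  moreover have "- I \<in> sets lebesgue"
    using sets.compl_sets[OF assms(2)] by (simp add: Compl_eq_Diff_UNIV)
  ultimately show ?thesis
    using meas by (auto simp: simple_function_def intro: finite_subset)
qed

text \<open>Differences of simple functions are simple, so their norms are measurable real functions
  even when \<open>'a\<close> is not separable; the claim follows by an almost everywhere limit of
  real functions.\<close>

lemma strongly_measurable_on_translation_diff:
  fixes f :: "real \<Rightarrow> 'a::real_normed_vector"
  assumes f: "strongly_measurable_on I f" and I: "I \<in> sets lebesgue"
    and "{a..b} \<subseteq> I" "{a + \<tau>..b + \<tau>} \<subseteq> I"
  shows "(\<lambda>x. indicator {a..b} x * norm (f (x + \<tau>) - f x)) \<in> borel_measurable lebesgue"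
proof -
  obtain s where s: "\<And>n::nat. simple_function (lebesgue_on I) (s n)"
    and lim: "AE x in lebesgue_on I. (\<lambda>n. s n x) \<longlonglongrightarrow> f x"
    using f by (auto simp: strongly_measurable_on_def)
  define r where "r n x = (if x \<in> I then s n x else 0)" for n x
  have r: "simple_function lebesgue (r n)" for n
    unfolding r_def by (rule simple_function_lebesgue_on_extend[OF s I])
  have "AE x in lebesgue. x \<in> I \<longrightarrow> (\<lambda>n. s n x) \<longlonglongrightarrow> f x"
    using lim I by (simp add: AE_restrict_space_iff)
  then have rlim: "AE x in lebesgue. x \<in> I \<longrightarrow> (\<lambda>n. r n x) \<longlonglongrightarrow> f x"
    by (simp add: r_def)
  have shift: "(\<lambda>x. x + \<tau>) \<in> lebesgue \<rightarrow>\<^sub>M lebesgue"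
    using lebesgue_affine_measurable[of "\<lambda>_. 1" \<tau>] by (simp add: add.commute)
  have "simple_function lebesgue (\<lambda>x. norm (r n (x + \<tau>) - r n x))" for n
    by (intro simple_function_compose1[where g = norm] simple_function_diff
        simple_function_comp[OF shift r] r)
  then have meas: "(\<lambda>x. norm (r n (x + \<tau>) - r n x)) \<in> borel_measurable lebesgue" for n
    by (rule borel_measurable_simple_function)
  define g where "g n x = indicator {a..b} x * norm (r n (x + \<tau>) - r n x)" for n x
  have g: "g n \<in> borel_measurable lebesgue" for n
    unfolding g_def by (intro borel_measurable_times borel_measurable_indicator meas) simp
  \<comment> \<open>The indicator confines attention to points with both \<open>x\<close> and
    \<open>x + \<tau>\<close> in \<open>I\<close>, where the two almost everywhere limits
    apply.\<close>
  have ae: "AE x in lebesgue. (\<lambda>n. g n x) \<longlonglongrightarrow> indicator {a..b} x * norm (f (x + \<tau>) - f x)"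
    using rlim AE_lebesgue_translation[OF rlim, of \<tau>]
  proof eventually_elim
    case (elim x)
    show ?case
    proof (cases "x \<in> {a..b}")
      case True
      then have "x \<in> I" "x + \<tau> \<in> I" using assms(3,4) by auto
      then show ?thesis
        using elim unfolding g_def by (intro tendsto_intros) auto
    qed (simp add: g_def)
  qed
  \<comment> \<open>The pointwise \<open>lim\<close> is measurable; completeness of
    \<open>lebesgue\<close> carries this over to a function equal to it almost everywhere.\<close>
  have "(\<lambda>x. lim (\<lambda>n. g n x)) \<in> borel_measurable lebesgue"
    using g by measurable
  moreover have "AE x in lebesgue. lim (\<lambda>n. g n x) = indicator {a..b} x * norm (f (x + \<tau>) - f x)"
    using ae by eventually_elim (rule limI)
  ultimately show ?thesis
    by (rule borel_measurable_AE)
qed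

section \<open>Integrability of powers of translated differences\<close>

lemma powr_norm_add_le:
  fixes x y :: "'a::real_normed_vector"
  assumes "0 \<le> p"
  shows "norm (x + y) powr p \<le> 2 powr p * (norm x powr p + norm y powr p)"
proof -
  have "norm (x + y) \<le> 2 * max (norm x) (norm y)"
    using norm_triangle_ineq[of x y] by linarith
  then have "norm (x + y) powr p \<le> (2 * max (norm x) (norm y)) powr p"
    using assms by (intro powr_mono2) auto
  also have "\<dots> = 2 powr p * max (norm x) (norm y) powr p"
    by (intro powr_mult)
  also have "\<dots> \<le> 2 powr p * (norm x powr p + norm y powr p)"
    by (intro mult_left_mono) (auto simp: max_def)
  finally show ?thesis .
qed

lemma set_integrable_lebesgue_translation_iff:
  fixes g :: "real \<Rightarrow> real"
  shows "set_integrable lebesgue {a..b} (\<lambda>s. g (s + \<tau>)) \<longleftrightarrow>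
    set_integrable lebesgue {a + \<tau>..b + \<tau>} g"
proof -
  have "(\<lambda>s. indicator {a + \<tau>..b + \<tau>} (\<tau> + s) *\<^sub>R g (\<tau> + s)) =
      (\<lambda>s. indicator {a..b} s *\<^sub>R g (s + \<tau>))"
    by (auto simp: indicator_def add.commute)
  then show ?thesis
    using lebesgue_integrable_real_affine_iff[of 1
        "\<lambda>s. indicator {a + \<tau>..b + \<tau>} s *\<^sub>R g s" \<tau>]
    by (simp add: set_integrable_def)
qed

lemma set_lebesgue_integral_translation:
  fixes g :: "real \<Rightarrow> real"
  shows "(LINT s:{a..b}|lebesgue. g (s + \<tau>)) = (LINT s:{a + \<tau>..b + \<tau>}|lebesgue. g s)"
proof -
  have "(\<lambda>s. indicator {a + \<tau>..b + \<tau>} (\<tau> + s) *\<^sub>R g (\<tau> + s)) =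
      (\<lambda>s. indicator {a..b} s *\<^sub>R g (s + \<tau>))"
    by (auto simp: indicator_def add.commute)
  then show ?thesis
    using lebesgue_integral_real_affine[of 1
        "\<lambda>s. indicator {a + \<tau>..b + \<tau>} s *\<^sub>R g s" \<tau>]
    by (simp add: set_lebesgue_integral_def)
qed

text \<open>Both intervals are compact subsets of \<open>I\<close>, so local integrability of the
  power of \<open>norm f\<close> on each of them supplies an integrable majorant through
  \<open>powr_norm_add_le\<close>.\<close>

lemma set_integrable_powr_translation_diff:
  fixes f :: "real \<Rightarrow> 'a::real_normed_vector"
  assumes f: "f \<in> Lp_loc p I" and I: "I \<in> sets lebesgue" and p: "0 < p"
    and sub: "{a..b} \<subseteq> I" "{a + \<tau>..b + \<tau>} \<subseteq> I"
  shows "set_integrable lebesgue {a..b} (\<lambda>s. norm (f (s + \<tau>) - f s) powr p)"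
proof -
  have "set_integrable lebesgue {a..b} (\<lambda>s. norm (f (s + \<tau>)) powr p)"
    using f sub(2) by (subst set_integrable_lebesgue_translation_iff) (simp add: Lp_loc_def)
  moreover have "set_integrable lebesgue {a..b} (\<lambda>s. norm (f s) powr p)"
    using f sub(1) by (simp add: Lp_loc_def)
  ultimately have dom: "set_integrable lebesgue {a..b}
      (\<lambda>s. 2 powr p * (norm (f (s + \<tau>)) powr p + norm (f s) powr p))"
    by (intro set_integrable_mult_right set_integral_add)
  have "(\<lambda>x. (indicator {a..b} x * norm (f (x + \<tau>) - f x)) powr p) \<in> borel_measurable lebesgue"
    using strongly_measurable_on_translation_diff[OF _ I sub, of f] f
    by (intro powr_real_measurable) (auto simp: Lp_loc_def)
  also have "(\<lambda>x. (indicator {a..b} x * norm (f (x + \<tau>) - f x)) powr p) =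
      (\<lambda>x. indicator {a..b} x *\<^sub>R norm (f (x + \<tau>) - f x) powr p)"
    by (auto simp: indicator_def)
  finally have meas: "(\<lambda>x. indicator {a..b} x *\<^sub>R norm (f (x + \<tau>) - f x) powr p)
      \<in> borel_measurable lebesgue" .
  show ?thesis
    unfolding set_integrable_def
  proof (rule Bochner_Integration.integrable_bound[OF dom[unfolded set_integrable_def] meas AE_I2])
    fix x
    show "norm (indicator {a..b} x *\<^sub>R norm (f (x + \<tau>) - f x) powr p) \<le>
        norm (indicator {a..b} x *\<^sub>R
          (2 powr p * (norm (f (x + \<tau>)) powr p + norm (f x) powr p)))"
      using powr_norm_add_le[of p "f (x + \<tau>)" "- f x"] p by (auto simp: indicator_def)
  qed
qed

section \<open>Limits of Stepanov differences for sums and multiples of shifts\<close>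

lemma filterlim_translation_at_infinity:
  fixes I :: "real set"
  assumes "\<And>t. t \<in> I \<Longrightarrow> t + \<sigma> \<in> I"
  shows "filterlim (\<lambda>t. t + \<sigma>) (inf at_infinity (principal I)) (inf at_infinity (principal I))"
proof -
  have "filterlim (\<lambda>t. t + \<sigma>) at_infinity (inf at_infinity (principal I))"
    by (intro filterlim_mono[OF tendsto_add_filterlim_at_infinity'[OF filterlim_ident tendsto_const]])
      auto
  moreover have "eventually (\<lambda>t. t + \<sigma> \<in> I) (inf at_infinity (principal I))"
    using assms by (simp add: eventually_inf_principal)
  ultimately show ?thesis
    by (simp add: filterlim_inf filterlim_principal)
qed

text \<open>The shift precedes the window start, so that limits in \<open>t\<close> can be taken at
  a fixed shift. No \<open>p\<close>-th root is taken, as in \<open>SpSAP\<close> and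
  \<open>SpQAAP\<close>; adding shifts therefore costs a factor \<open>2 powr p\<close>.\<close>

definition stepanov_diff :: "real \<Rightarrow> (real \<Rightarrow> 'a::real_normed_vector) \<Rightarrow> real \<Rightarrow> real \<Rightarrow> real"
  where "stepanov_diff p f \<tau> t = (LINT s:{t..t + 1}|lebesgue. norm (f (s + \<tau>) - f s) powr p)"

lemma stepanov_diff_nonneg: "0 \<le> stepanov_diff p f \<tau> t"
  unfolding stepanov_diff_def set_lebesgue_integral_def by (rule integral_nonneg_AE) simp

lemma stepanov_diff_translation:
  "(LINT s:{t..t + 1}|lebesgue. norm (f (s + \<sigma> + \<tau>) - f (s + \<sigma>)) powr p) =
    stepanov_diff p f \<tau> (t + \<sigma>)"
  using set_lebesgue_integral_translation[of t "t + 1" "\<lambda>s. norm (f (s + \<tau>) - f s) powr p" \<sigma>]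
  by (simp add: stepanov_diff_def add_ac)

text \<open>With \<open>u = s - \<tau>\<close>, the difference \<open>f (s - \<tau>) - f s\<close>
  is the negative of \<open>f (u + \<tau>) - f u\<close>, and the norm ignores the sign.\<close>

lemma stepanov_diff_uminus: "stepanov_diff p f (- \<tau>) t = stepanov_diff p f \<tau> (t - \<tau>)"
  using stepanov_diff_translation[of t f "- \<tau>" \<tau> p]
  by (simp add: stepanov_diff_def norm_minus_commute)

text \<open>Insert the intermediate value \<open>f (s + \<sigma>)\<close>: the step from there by
  \<open>\<tau>\<close> is a difference seen from the window at \<open>t + \<sigma>\<close>. The
  three windows in the assumptions are those on which \<open>f\<close> is evaluated.\<close>

lemma stepanov_diff_add_le:
  assumes f: "f \<in> Lp_loc p I" and I: "I \<in> sets lebesgue" and p: "0 < p"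
    and sub: "{t..t + 1} \<subseteq> I" "{t + \<sigma>..t + \<sigma> + 1} \<subseteq> I" "{t + \<sigma> + \<tau>..t + \<sigma> + \<tau> + 1} \<subseteq> I"
  shows "stepanov_diff p f (\<sigma> + \<tau>) t \<le>
    2 powr p * (stepanov_diff p f \<tau> (t + \<sigma>) + stepanov_diff p f \<sigma> t)"
proof -
  let ?A = "\<lambda>s. norm (f (s + \<sigma> + \<tau>) - f (s + \<sigma>)) powr p"
  let ?B = "\<lambda>s. norm (f (s + \<sigma>) - f s) powr p"
  have "set_integrable lebesgue {t + \<sigma>..t + 1 + \<sigma>} (\<lambda>s. norm (f (s + \<tau>) - f s) powr p)"
    using sub by (intro set_integrable_powr_translation_diff[OF f I p]) (simp_all add: add_ac)
  then have A: "set_integrable lebesgue {t..t + 1} ?A"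
    using set_integrable_lebesgue_translation_iff[of t "t + 1"
        "\<lambda>s. norm (f (s + \<tau>) - f s) powr p" \<sigma>] by simp
  have B: "set_integrable lebesgue {t..t + 1} ?B"
    using sub by (intro set_integrable_powr_translation_diff[OF f I p]) (simp_all add: add_ac)
  have "stepanov_diff p f (\<sigma> + \<tau>) t \<le> (LINT s:{t..t + 1}|lebesgue. 2 powr p * (?A s + ?B s))"
    unfolding stepanov_diff_def set_lebesgue_integral_def
  proof (rule integral_mono')
    show "integrable lebesgue (\<lambda>s. indicator {t..t + 1} s *\<^sub>R (2 powr p * (?A s + ?B s)))"
      using A B unfolding set_integrable_def[symmetric]
      by (intro set_integrable_mult_right set_integral_add)
    show "indicator {t..t + 1} s *\<^sub>R norm (f (s + (\<sigma> + \<tau>)) - f s) powr p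
        \<le> indicator {t..t + 1} s *\<^sub>R (2 powr p * (?A s + ?B s))" for s
      using powr_norm_add_le[of p "f (s + \<sigma> + \<tau>) - f (s + \<sigma>)" "f (s + \<sigma>) - f s"] p
      by (auto simp: indicator_def add_ac)
  qed auto
  also have "\<dots> = 2 powr p * (stepanov_diff p f \<tau> (t + \<sigma>) + stepanov_diff p f \<sigma> t)"
    using A B by (simp add: set_integral_add stepanov_diff_translation stepanov_diff_def[of p f \<sigma>])
  finally show ?thesis .
qed

lemma stepanov_diff_tendsto_add:
  assumes f: "f \<in> Lp_loc p I" and I: "I = UNIV \<or> I = {0..}" and p: "0 < p"
    and mem: "\<sigma> \<in> I" "\<tau> \<in> I"
    and lim: "(stepanov_diff p f \<sigma> \<longlongrightarrow> 0) (inf at_infinity (principal I))"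
      "(stepanov_diff p f \<tau> \<longlongrightarrow> 0) (inf at_infinity (principal I))"
  shows "(stepanov_diff p f (\<sigma> + \<tau>) \<longlongrightarrow> 0) (inf at_infinity (principal I))"
proof (rule tendsto_sandwich)
  show "eventually (\<lambda>t. 0 \<le> stepanov_diff p f (\<sigma> + \<tau>) t) (inf at_infinity (principal I))"
    by (simp add: stepanov_diff_nonneg)
  have "I \<in> sets lebesgue"
    using I by auto
  \<comment> \<open>\<open>I\<close> is closed under addition and under moving to the right, which
    places all three windows inside it.\<close>
  then have "stepanov_diff p f (\<sigma> + \<tau>) t \<le>
      2 powr p * (stepanov_diff p f \<tau> (t + \<sigma>) + stepanov_diff p f \<sigma> t)" if "t \<in> I" for t
    using I mem that by (intro stepanov_diff_add_le[OF f _ p]) auto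
  then show "eventually (\<lambda>t. stepanov_diff p f (\<sigma> + \<tau>) t \<le>
      2 powr p * (stepanov_diff p f \<tau> (t + \<sigma>) + stepanov_diff p f \<sigma> t))
      (inf at_infinity (principal I))"
    by (simp add: eventually_inf_principal)
  have "((\<lambda>t. stepanov_diff p f \<tau> (t + \<sigma>)) \<longlongrightarrow> 0) (inf at_infinity (principal I))"
    using I mem(1) by (intro filterlim_compose[OF lim(2) filterlim_translation_at_infinity]) auto
  then show "((\<lambda>t. 2 powr p * (stepanov_diff p f \<tau> (t + \<sigma>) + stepanov_diff p f \<sigma> t)) \<longlongrightarrow> 0)
      (inf at_infinity (principal I))"
    using lim(1) by (auto intro!: tendsto_eq_intros)
qed (rule tendsto_const)

lemma stepanov_diff_tendsto_of_nat_mult: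
  assumes f: "f \<in> Lp_loc p I" and I: "I = UNIV \<or> I = {0..}" and p: "0 < p" and mem: "\<sigma> \<in> I"
    and lim: "(stepanov_diff p f \<sigma> \<longlongrightarrow> 0) (inf at_infinity (principal I))"
  shows "(stepanov_diff p f (of_nat n * \<sigma>) \<longlongrightarrow> 0) (inf at_infinity (principal I))"
proof (induction n)
  case 0
  have "stepanov_diff p f 0 = (\<lambda>t. 0)"
    by (simp add: stepanov_diff_def fun_eq_iff)
  then show ?case by simp
next
  case (Suc n)
  have "of_nat n * \<sigma> \<in> I"
    using I mem by auto
  from stepanov_diff_tendsto_add[OF f I p mem this lim Suc] show ?case
    by (simp add: algebra_simps)
qed

lemma stepanov_diff_tendsto_of_int_mult:
  assumes f: "f \<in> Lp_loc p I" and I: "I = UNIV \<or> I = {0..}" and p: "0 < p"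
    and mem: "\<sigma> \<in> I" "\<sigma> \<noteq> 0" "of_int k * \<sigma> \<in> I"
    and lim: "(stepanov_diff p f \<sigma> \<longlongrightarrow> 0) (inf at_infinity (principal I))"
  shows "(stepanov_diff p f (of_int k * \<sigma>) \<longlongrightarrow> 0) (inf at_infinity (principal I))"
proof (cases "0 \<le> k")
  case True
  then show ?thesis
    using stepanov_diff_tendsto_of_nat_mult[OF f I p mem(1) lim, of "nat k"] by simp
next
  case False
  \<comment> \<open>On the half-line \<open>\<sigma>\<close> is positive, so a negative multiple
    would lie outside \<open>I\<close>.\<close>
  then have "I = UNIV"
    using I mem by (auto simp: zero_le_mult_iff)
  define \<tau> where "\<tau> = of_nat (nat (- k)) * \<sigma>"
  have "(stepanov_diff p f \<tau> \<longlongrightarrow> 0) (inf at_infinity (principal I))"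
    unfolding \<tau>_def by (rule stepanov_diff_tendsto_of_nat_mult[OF f I p mem(1) lim])
  then have "((\<lambda>t. stepanov_diff p f \<tau> (t + - \<tau>)) \<longlongrightarrow> 0) (inf at_infinity (principal I))"
    using \<open>I = UNIV\<close> by (intro filterlim_compose[OF _ filterlim_translation_at_infinity]) auto
  moreover have "of_int k * \<sigma> = - \<tau>"
    using False by (simp add: \<tau>_def)
  ultimately show ?thesis
    by (simp add: stepanov_diff_uminus[abs_def])
qed

text \<open>The length exceeds \<open>2 * \<bar>\<omega>\<bar>\<close>, so \<open>J\<close> does not
  fit into the closed ball of radius \<open>\<bar>\<omega>\<bar>\<close> around one of its points.
  Two points of \<open>J\<close> thus lie more than \<open>\<bar>\<omega>\<bar>\<close> apart and
  enclose a multiple of \<open>\<omega>\<close>, whether or not \<open>J\<close> contains its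
  endpoints.\<close>

lemma interval_contains_int_multiple:
  fixes \<omega> :: real
  assumes "is_interval J" "\<omega> \<noteq> 0" "emeasure lborel J = ennreal (3 * \<bar>\<omega>\<bar>)"
  shows "\<exists>k. of_int k * \<omega> \<in> J"
proof -
  have "J \<noteq> {}"
    using assms(2,3) by auto
  then obtain x where x: "x \<in> J" by auto
  have "\<not> J \<subseteq> {x - \<bar>\<omega>\<bar>..x + \<bar>\<omega>\<bar>}"
  proof
    assume "J \<subseteq> {x - \<bar>\<omega>\<bar>..x + \<bar>\<omega>\<bar>}"
    then have "emeasure lborel J \<le> emeasure lborel {x - \<bar>\<omega>\<bar>..x + \<bar>\<omega>\<bar>}"
      by (rule emeasure_mono) simp
    then show False
      using assms(2,3) by (simp add: ennreal_le_iff)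
  qed
  then obtain y where y: "y \<in> J" "\<bar>y - x\<bar> > \<bar>\<omega>\<bar>"
    by (auto simp: subset_eq abs_if split: if_splits)
  \<comment> \<open>The first multiple of \<open>\<bar>\<omega>\<bar>\<close> at or above the
    smaller point overshoots it by less than \<open>\<bar>\<omega>\<bar>\<close>, so it stays below
    the larger point.\<close>
  define k where "k = \<lceil>min x y / \<bar>\<omega>\<bar>\<rceil>"
  have "min x y / \<bar>\<omega>\<bar> \<le> of_int k" "of_int k < min x y / \<bar>\<omega>\<bar> + 1"
    unfolding k_def by linarith+
  then have "min x y \<le> of_int k * \<bar>\<omega>\<bar>" "of_int k * \<bar>\<omega>\<bar> < min x y + \<bar>\<omega>\<bar>"
    using assms(2) by (simp_all add: field_simps)
  moreover have "min x y + \<bar>\<omega>\<bar> < max x y" "min x y \<in> J" "max x y \<in> J"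
    using x y by (auto simp: min_def max_def)
  ultimately have "of_int k * \<bar>\<omega>\<bar> \<in> J"
    using assms(1) unfolding is_interval_1 by (meson less_imp_le less_trans)
  moreover have "of_int k * \<bar>\<omega>\<bar> = of_int (if \<omega> < 0 then - k else k) * \<omega>"
    by simp
  ultimately show ?thesis by metis
qed

section \<open>The inclusion of the two function spaces\<close>

theorem proposition2p11:
  fixes p \<omega> :: real and I :: "real set"
  assumes "\<exists>x :: 'a::complex_banach. x \<noteq> 0"
    and "1 \<le> p"
    and "I = UNIV \<or> I = {0..}"
    and "\<omega> \<in> I" and "\<omega> \<noteq> 0"
  shows "(SpSAP p \<omega> I :: (real \<Rightarrow> 'a) set) \<subseteq> SpQAAP p I"
proof
  fix f :: "real \<Rightarrow> 'a"
  assume "f \<in> SpSAP p \<omega> I"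
  then have bdd: "f \<in> stepanov_bounded p I"
    and lim: "(stepanov_diff p f \<omega> \<longlongrightarrow> 0) (inf at_infinity (principal I))"
    by (simp_all add: SpSAP_def stepanov_diff_def[abs_def])
  have f: "f \<in> Lp_loc p I"
    using bdd by (simp add: stepanov_bounded_def)
  have ap: "\<exists>M>0. \<forall>t\<in>I. \<bar>t\<bar> \<ge> M \<longrightarrow> stepanov_diff p f (of_int k * \<omega>) t \<le> \<epsilon> powr p"
    if "\<epsilon> > 0" "of_int k * \<omega> \<in> I" for \<epsilon> k
  proof -
    have "(stepanov_diff p f (of_int k * \<omega>) \<longlongrightarrow> 0) (inf at_infinity (principal I))"
      using assms that(2) by (intro stepanov_diff_tendsto_of_int_mult[OF f _ _ _ _ _ lim]) auto
    moreover have "0 < \<epsilon> powr p"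
      using that(1) by simp
    ultimately have "eventually (\<lambda>t. stepanov_diff p f (of_int k * \<omega>) t < \<epsilon> powr p)
        (inf at_infinity (principal I))"
      by (rule order_tendstoD(2))
    then obtain b where b: "\<And>t. b \<le> \<bar>t\<bar> \<Longrightarrow> t \<in> I \<Longrightarrow>
        stepanov_diff p f (of_int k * \<omega>) t < \<epsilon> powr p"
      by (auto simp: eventually_inf_principal eventually_at_infinity)
    show ?thesis
      \<comment> \<open>The bound \<open>b\<close> obtained from the filter may be nonpositive,
        whereas \<open>M\<close> must be positive.\<close>
      by (rule exI[of _ "max b 1"]) (auto intro: less_imp_le b)
  qed
  \<comment> \<open>The length \<open>3 * \<bar>\<omega>\<bar>\<close> serves every
    \<open>\<epsilon>\<close>; only \<open>M\<close> varies with \<open>\<epsilon>\<close> and the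
    multiple. The inclusion of \<open>J\<close> in \<open>I\<close> supplies the membership that
    \<open>ap\<close> asks of the multiple.\<close>
  have "\<exists>L>0. \<forall>J. is_interval J \<and> J \<subseteq> I \<and> emeasure lborel J = ennreal L \<longrightarrow>
      (\<exists>\<tau>\<in>J. \<exists>M>0. \<forall>t\<in>I. \<bar>t\<bar> \<ge> M \<longrightarrow> stepanov_diff p f \<tau> t \<le> \<epsilon> powr p)"
    if "\<epsilon> > 0" for \<epsilon>
  proof (intro exI[of _ "3 * \<bar>\<omega>\<bar>"] conjI allI impI)
    fix J assume J: "is_interval J \<and> J \<subseteq> I \<and> emeasure lborel J = ennreal (3 * \<bar>\<omega>\<bar>)"
    then obtain k where "of_int k * \<omega> \<in> J"
      using interval_contains_int_multiple assms(5) by blast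
    with J ap[OF that, of k] show "\<exists>\<tau>\<in>J. \<exists>M>0. \<forall>t\<in>I. \<bar>t\<bar> \<ge> M \<longrightarrow>
        stepanov_diff p f \<tau> t \<le> \<epsilon> powr p"
      by blast
  qed (use assms(5) in simp)
  then show "f \<in> SpQAAP p I"
    using bdd by (simp add: SpQAAP_def stepanov_diff_def)
qed

end
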